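(* Let $(Z_n)_{n\ge0}$ be a BPIRE (as in the context) with offspring p.g.f. $\varphi_n$ and $M_n$ immigrants in generation $n$, which is an irreducible Markov chain under $Q$ (on state space $\mathbb{N}$ or $\mathbb{N}_0$). Assume: (1) $(\varphi_n,M_n)_{n\in\mathbb{N}}$ is i.i.d. under $Q$; (2) with $\mu_n:=\varphi_n'(1)$, $E_Q[|\log\mu_1|^{\delta}]<\infty$ for every $0<\delta<6$ and $E_Q[\log\mu_1]=0$; (3) $E_Q\big[\big(\log_+(\operatorname{Var}_{\varphi}(\xi^{(1)}_1)\cdot\mu_1^{-2})\big)^2\big]<\infty$; (4) $\liminf_{t\to\infty}\big(t^{\lambda}\cdot Q[\log M_1>t]\big)>0$ for some $0<\lambda<2$. Then $(Z_n)_{n\ge0}$ is transient.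
   Context: Branching process in random environment with immigration (BPIRE): the environment is a sequence $(\varphi_n,M_n)_{n\in\mathbb{N}}$ of pairs, where $\varphi_n$ is a (random) probability generating function of a distribution on $\mathbb{N}_0$ and $M_n$ is an $\mathbb{N}_0$-valued random variable, defined on a probability space with measure $Q$. Conditionally on the environment, $\{\xi^{(n)}_j: j,n\in\mathbb{N}\}$ are independent, with $\xi^{(n)}_j$ having p.g.f. $\varphi_n$. Set $Z_0:=0$ and $Z_n:=\xi^{(n)}_1+\dots+\xi^{(n)}_{Z_{n-1}}+M_n$ for $n\ge1$. Under $Q$, $(Z_n)$ is a time-homogeneous Markov chain; recurrence/transience refer to this chain. $Q_\varphi:=Q[\cdot\mid(\varphi_n)_n]$ and $\operatorname{Var}_\varphi$ denotes variance under $Q_\varphi$ (so $\operatorname{Var}_\varphi(\xi^{(1)}_1)$ is the variance of the distribution with p.g.f. $\varphi_1$). $\log_+x=\max(\log x,0)$. *)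

theory Defs
  imports "HOL-Probability.Probability"
begin

text \<open>Measurable space on offspring laws (p.g.f.s): generated by the point masses.\<close>
definition pmf_space :: "nat pmf measure" where
  "pmf_space = vimage_algebra UNIV pmf (Pi\<^sub>M UNIV (\<lambda>_::nat. (borel :: real measure)))"

definition env_space :: "(nat pmf \<times> nat) measure" where
  "env_space = pmf_space \<Otimes>\<^sub>M count_space UNIV"

fun sum_pmf :: "nat pmf \<Rightarrow> nat \<Rightarrow> nat pmf" where
  "sum_pmf p 0 = return_pmf 0"
| "sum_pmf p (Suc n) = bind_pmf (sum_pmf p n) (\<lambda>a. map_pmf (\<lambda>b. a + b) p)"

text \<open>Transition kernel of the BPIRE under the annealed law Q, for an i.i.d.
  environment whose one-generation marginal is (phi, M):
  Q[Z_{n+1} = y | Z_n = x] = E_Q[ Q_phi(xi_1 + ... + xi_x + M = y) ].\<close>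
definition bpire_kernel :: "'w measure \<Rightarrow> ('w \<Rightarrow> nat pmf) \<Rightarrow> ('w \<Rightarrow> nat) \<Rightarrow> nat \<Rightarrow> nat \<Rightarrow> real" where
  "bpire_kernel Q phi M x y = (\<integral>\<omega>. pmf (map_pmf (\<lambda>s. s + M \<omega>) (sum_pmf (phi \<omega>) x)) y \<partial>Q)"

fun kernel_pow :: "(nat \<Rightarrow> nat \<Rightarrow> real) \<Rightarrow> nat \<Rightarrow> nat \<Rightarrow> nat \<Rightarrow> real" where
  "kernel_pow P 0 x y = (if x = y then 1 else 0)"
| "kernel_pow P (Suc n) x y = (\<Sum>z. P x z * kernel_pow P n z y)"

fun first_passage :: "(nat \<Rightarrow> nat \<Rightarrow> real) \<Rightarrow> nat \<Rightarrow> nat \<Rightarrow> nat \<Rightarrow> real" where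
  "first_passage P 0 x y = 0"
| "first_passage P (Suc 0) x y = P x y"
| "first_passage P (Suc (Suc n)) x y =
     (\<Sum>z. if z = y then 0 else P x z * first_passage P (Suc n) z y)"

definition return_prob :: "(nat \<Rightarrow> nat \<Rightarrow> real) \<Rightarrow> nat \<Rightarrow> real" where
  "return_prob P x = (\<Sum>n. first_passage P n x x)"

definition transient_state :: "(nat \<Rightarrow> nat \<Rightarrow> real) \<Rightarrow> nat \<Rightarrow> bool" where
  "transient_state P x \<longleftrightarrow> return_prob P x < 1"

definition closed_on :: "(nat \<Rightarrow> nat \<Rightarrow> real) \<Rightarrow> nat set \<Rightarrow> bool" where
  "closed_on P S \<longleftrightarrow> (\<forall>x\<in>S. \<forall>y. P x y > 0 \<longrightarrow> y \<in> S)"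

definition irreducible_on :: "(nat \<Rightarrow> nat \<Rightarrow> real) \<Rightarrow> nat set \<Rightarrow> bool" where
  "irreducible_on P S \<longleftrightarrow> (\<forall>x\<in>S. \<forall>y\<in>S. \<exists>n. kernel_pow P n x y > 0)"

definition pmf_mean :: "nat pmf \<Rightarrow> ennreal" where
  "pmf_mean p = (\<integral>\<^sup>+ k. ennreal (real k) \<partial>measure_pmf p)"

definition pmf_var :: "nat pmf \<Rightarrow> ennreal" where
  "pmf_var p = (if pmf_mean p = \<infinity> then \<infinity>
     else (\<integral>\<^sup>+ k. ennreal ((real k - enn2real (pmf_mean p))\<^sup>2) \<partial>measure_pmf p))"

definition log_plus :: "real \<Rightarrow> real" where
  "log_plus x = (if x \<le> 1 then 0 else ln x)"

end

theory Submission
  imports Defs "HOL-Real_Asymp.Real_Asymp"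
begin

text \<open>
  On the log scale the chain is a centred random walk with finite variance that is pushed up to
  \<open>log M\<^sub>n\<close>. With \<open>u = log x\<close> and the Lyapunov function \<open>V(x) = (1 + log x)\<^bsup>-e\<^esup>\<close>, the walk and the
  offspring fluctuations raise the expectation of \<open>V\<close> by only \<open>O(1 / u\<^sup>2)\<close> in one step, whereas the
  event \<open>log M > 4u\<close>, of probability at least \<open>c u\<^bsup>-lam\<^esup>\<close>, lowers it by order \<open>u\<^bsup>-lam-e\<^esup>\<close>. If
  \<open>lam + e < 2\<close> then \<open>V\<close> is superharmonic outside a finite set and tends to 0, so from far away
  the chain has a positive probability of never coming back.
\<close>

section \<open>First-passage probabilities and superharmonic functions\<close>

lemma first_passage_Suc:
  "first_passage P (Suc n) z x =
     (if n = 0 then P z x else 0) + (\<Sum>w. if w = x then 0 else P z w * first_passage P n w x)"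
  by (cases n) (auto cong: if_cong)

lemma first_passage_bounds:
  assumes "\<And>z w. 0 \<le> P z w" and "\<And>z. P z sums 1"
  shows "0 \<le> first_passage P n z x \<and> first_passage P n z x \<le> 1"
proof (induction n arbitrary: z)
  case (Suc n)
  have P1: "P z w \<le> 1" for w
    using assms sum_le_suminf[of "P z" "{w}"] by (auto simp: sums_iff)
  show ?case
  proof (cases "n = 0")
    case False
    let ?t = "\<lambda>w. if w = x then 0 else P z w * first_passage P n w x"
    have t: "0 \<le> ?t w" "?t w \<le> P z w" for w
      using Suc.IH[of w] assms(1)[of z w] by (auto simp: mult_left_le)
    have s: "summable ?t"
      by (rule summable_comparison_test'[of "P z" 0]) (use t assms in \<open>auto simp: sums_iff\<close>)
    have "suminf ?t \<le> suminf (P z)"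
      using s t assms(2) by (intro suminf_le) (auto simp: sums_iff)
    then show ?thesis
      using False suminf_nonneg[OF s] t assms(2)[of z] by (simp add: first_passage_Suc sums_iff)
  qed (use P1 assms in \<open>auto simp: first_passage_Suc cong: if_cong\<close>)
qed simp

lemma kernel_pow_bounds:
  assumes "\<And>z w. 0 \<le> P z w" and "\<And>z. P z sums 1"
  shows "0 \<le> kernel_pow P n z w \<and> kernel_pow P n z w \<le> 1"
proof (induction n arbitrary: z)
  case (Suc n)
  let ?t = "\<lambda>v. P z v * kernel_pow P n v w"
  have t: "0 \<le> ?t v" "?t v \<le> P z v" for v
    using Suc.IH[of v] assms(1)[of z v] by (auto simp: mult_left_le)
  have s: "summable ?t"
    by (rule summable_comparison_test'[of "P z" 0]) (use t assms in \<open>auto simp: sums_iff\<close>)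
  have "suminf ?t \<le> suminf (P z)"
    using s t assms(2) by (intro suminf_le) (auto simp: sums_iff)
  then show ?case
    using suminf_nonneg[OF s] t assms(2)[of z] by (simp add: sums_iff)
qed simp

text \<open>One-step analysis: a first jump to \<open>x\<close> succeeds outright, hence
  \<open>f x = 1\<close>, and a first jump to any other \<open>w\<close> leaves at most
  \<open>N\<close> further steps, for which \<open>f w\<close> is an upper bound. It is applied to a
  superharmonic \<open>f\<close> and also to the hitting probability itself, raised to 1 at all
  states but one.\<close>

lemma first_passage_sum_le:
  assumes P: "\<And>z w. 0 \<le> P z w" "\<And>z. P z sums 1"
    and f: "\<And>w. (\<Sum>n\<le>N. first_passage P n w x) \<le> f w" "\<And>w. f w \<le> 1" "f x = 1"
  shows "(\<Sum>n\<le>Suc N. first_passage P n z x) \<le> (\<Sum>w. P z w * f w)"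
proof -
  let ?t = "\<lambda>n w. if w = x then 0 else P z w * first_passage P n w x"
  note b = first_passage_bounds[of P, OF P]
  have t: "0 \<le> ?t n w" "?t n w \<le> P z w" for n w
    using b[of n w x] P(1)[of z w] by (auto simp: mult_left_le)
  have s: "summable (?t n)" for n
    by (rule summable_comparison_test'[of "P z" 0]) (use t P in \<open>auto simp: sums_iff\<close>)
  have f0: "0 \<le> f w" for w
    using b by (intro order_trans[OF _ f(1)] sum_nonneg) auto
  have sf: "summable (\<lambda>w. P z w * f w)"
    by (rule summable_comparison_test'[of "P z" 0])
       (use f0 f P in \<open>auto simp: sums_iff mult_left_le\<close>)
  have sg: "(\<lambda>w. if w = x then P z x else 0) sums P z x"
    using sums_single[of x "\<lambda>_. P z x"] by simp
  have "(\<Sum>n\<le>Suc N. first_passage P n z x) = (\<Sum>n\<le>N. first_passage P (Suc n) z x)"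
    by (simp only: sum.atMost_Suc_shift) simp
  also have "\<dots> = P z x + (\<Sum>n\<le>N. \<Sum>w. ?t n w)"
    by (simp add: first_passage_Suc sum.distrib del: first_passage.simps)
  also have "(\<Sum>n\<le>N. \<Sum>w. ?t n w) = (\<Sum>w. \<Sum>n\<le>N. ?t n w)"
    using s by (intro suminf_sum[symmetric])
  also have "P z x + (\<Sum>w. \<Sum>n\<le>N. ?t n w) =
      (\<Sum>w. (if w = x then P z x else 0) + (\<Sum>n\<le>N. ?t n w))"
    using sg s by (subst suminf_add[symmetric]) (auto simp: sums_iff summable_sum)
  also have "\<dots> \<le> (\<Sum>w. P z w * f w)"
  proof (intro suminf_le sf summable_add summable_sum s)
    fix w
    show "(if w = x then P z x else 0) + (\<Sum>n\<le>N. ?t n w) \<le> P z w * f w"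
      using f P(1)[of z w] by (auto simp: sum_distrib_left[symmetric] mult_left_mono)
  qed (use sg in \<open>auto simp: sums_iff\<close>)
  finally show ?thesis .
qed

text \<open>By induction on the time horizon, \<open>W\<close> dominates the probability
  \<open>h\<close> of reaching \<open>x\<close>, so \<open>h y < 1\<close>. If the return to
  \<open>x\<close> were certain, certainty would propagate along a path of positive probability from
  \<open>x\<close> to \<open>y\<close> and force \<open>h y = 1\<close>.\<close>

lemma transient_state_if_superharmonic:
  assumes P: "\<And>z w. 0 \<le> P z w" "\<And>z. P z sums 1"
    and W: "\<And>z. 0 \<le> W z" "\<And>z. W z \<le> 1" "\<And>z. (\<Sum>w. P z w * W w) \<le> W z"
    and "W x = 1" "kernel_pow P n x y > 0" "W y < 1"
  shows "transient_state P x"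
proof -
  let ?H = "\<lambda>N z. \<Sum>n\<le>N. first_passage P n z x"
  define h where "h z = (\<Sum>n. first_passage P n z x)" for z
  note b = first_passage_bounds[of P, OF P]
  have HW: "?H N z \<le> W z" for N z
  proof (induction N arbitrary: z)
    case (Suc N)
    show ?case
      using first_passage_sum_le[of P, OF P Suc.IH, of z] W(2,3) assms(6) order_trans by blast
  qed (use W in auto)
  have sm: "summable (\<lambda>n. first_passage P n z x)" for z
    using b order_trans[OF HW W(2)] by (intro bounded_imp_summable[where B=1]) auto
  have Hh: "?H N z \<le> h z" for N z
    unfolding h_def using b by (intro sum_le_suminf sm) auto
  have hW: "h z \<le> W z" for z
  proof -
    have "(\<lambda>N. ?H N z) \<longlonglongrightarrow> h z"
      unfolding h_def using sm[of z] by (rule summable_LIMSEQ')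
    then show ?thesis by (rule LIMSEQ_le_const2) (use HW in auto)
  qed
  have h1: "h z \<le> 1" for z using hW[of z] W(2)[of z] by simp
  \<comment> \<open>Bounding \<open>h\<close> by 1 at every target except \<open>w\<close> isolates
    the loss caused by the single jump from \<open>z\<close> to \<open>w\<close>. Hence
    \<open>h z = 1\<close> and \<open>P z w > 0\<close> force \<open>h w = 1\<close>.\<close>
  have step: "h z \<le> 1 - P z w * (1 - h w)" if "w \<noteq> x" for z w
  proof -
    let ?f = "\<lambda>v. if v = w then h w else 1"
    have "(\<lambda>v. P z v - (if v = w then P z w * (1 - h w) else 0)) sums (1 - P z w * (1 - h w))"
      using sums_single[of w "\<lambda>_. P z w * (1 - h w)"] by (intro sums_diff P) simp
    also have "(\<lambda>v. P z v - (if v = w then P z w * (1 - h w) else 0)) = (\<lambda>v. P z v * ?f v)"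
      by (auto simp: algebra_simps)
    finally have eq: "(\<Sum>v. P z v * ?f v) = 1 - P z w * (1 - h w)" by (simp add: sums_iff)
    have H: "?H (Suc N) z \<le> 1 - P z w * (1 - h w)" for N
      unfolding eq[symmetric]
      by (rule first_passage_sum_le[of P, OF P]) (use Hh h1 that order_trans[OF Hh h1] in auto)
    have "(\<lambda>N. ?H (Suc N) z) \<longlonglongrightarrow> h z"
      unfolding h_def by (rule LIMSEQ_Suc[OF summable_LIMSEQ'[OF sm]])
    then show ?thesis by (rule LIMSEQ_le_const2) (use H in auto)
  qed
  note kp0 = kernel_pow_bounds[of P, OF P, THEN conjunct1]
  have reach: "h z = 1 \<Longrightarrow> h y = 1"
    if "h x = 1" "kernel_pow P n z y > 0" for n z
    using that(2)
  proof (induction n arbitrary: z)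
    case (Suc n)
    have "\<exists>v. P z v * kernel_pow P n v y \<noteq> 0"
    proof (rule ccontr)
      assume "\<not> ?thesis"
      then have "(\<lambda>v. P z v * kernel_pow P n v y) = (\<lambda>v. 0)" by blast
      then have "kernel_pow P (Suc n) z y = 0" by (simp only: kernel_pow.simps suminf_zero)
      with Suc.prems(2) show False by simp
    qed
    then obtain v where v: "P z v > 0" "kernel_pow P n v y > 0"
      using P(1)[of z] kp0[of n _ y] by (auto simp: less_le)
    \<comment> \<open>The passage ends at \<open>x\<close>, so the bound \<open>step\<close> says
      nothing about a jump to \<open>x\<close>; there the assumption \<open>h x = 1\<close> takes
      over.\<close>
    have "h v = 1"
    proof (cases "v = x")
      case False
      from step[OF this, of z] Suc.prems v(1) have "P z v * (1 - h v) \<le> 0" by simp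
      with v(1) have "1 - h v \<le> 0" by (simp add: mult_le_0_iff)
      with h1[of v] show ?thesis by simp
    qed (use that in simp)
    then show ?case using Suc.IH v by blast
  qed (auto split: if_splits)
  have "h x \<noteq> 1"
    using reach[OF _ assms(7)] hW[of y] assms(8) by auto
  then show ?thesis
    using h1[of x] by (simp add: transient_state_def return_prob_def h_def)
qed

section \<open>Measurability in the offspring law and the annealed kernel\<close>

lemma measurable_pmf_space_nth [measurable]: "(\<lambda>p. pmf p k) \<in> borel_measurable pmf_space"
proof -
  have "pmf \<in> pmf_space \<rightarrow>\<^sub>M Pi\<^sub>M UNIV (\<lambda>_::nat. borel)"
    unfolding pmf_space_def by (rule measurable_vimage_algebra1) (auto simp: space_PiM)
  then show ?thesis
    by (rule measurable_compose[OF _ measurable_component_singleton]) simp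
qed

lemma nn_integral_measure_pmf_nat:
  fixes p :: "nat pmf"
  shows "(\<integral>\<^sup>+k. f k \<partial>measure_pmf p) = (\<Sum>k. ennreal (pmf p k) * f k)"
  by (simp add: nn_integral_measure_pmf nn_integral_count_space_nat)

lemma measurable_pmf_mean [measurable]: "pmf_mean \<in> borel_measurable pmf_space"
  unfolding pmf_mean_def nn_integral_measure_pmf_nat by measurable

lemma pmf_map_add: "pmf (map_pmf (\<lambda>s. s + m) p) k = (if m \<le> k then pmf p (k - m) else 0)"
  for m k :: nat
proof (cases "m \<le> k")
  case True
  then have "pmf (map_pmf (\<lambda>s. s + m) p) ((k - m) + m) = pmf p (k - m)"
    by (intro pmf_map_inj') (auto simp: inj_def)
  with True show ?thesis by simp
next
  case False
  then have "k \<notin> set_pmf (map_pmf (\<lambda>s. s + m) p)" by auto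
  with False show ?thesis unfolding set_pmf_iff by simp
qed

lemma measurable_sum_pmf [measurable]:
  "(\<lambda>p. pmf (sum_pmf p n) k) \<in> borel_measurable pmf_space"
proof (induction n arbitrary: k)
  case (Suc n)
  \<comment> \<open>The convolution is written as a series in \<open>ennreal\<close>, which is
    measurable in \<open>p\<close> with no summability to check, and \<open>enn2real\<close> brings
    it back to the reals.\<close>
  have "pmf (sum_pmf p (Suc n)) k =
      enn2real (\<Sum>a. ennreal (pmf (sum_pmf p n) a) * (if a \<le> k then ennreal (pmf p (k - a)) else 0))" for p
  proof -
    have "ennreal (pmf (map_pmf (\<lambda>b. a + b) p) k) = (if a \<le> k then ennreal (pmf p (k - a)) else 0)" for a
      using pmf_map_add[of a p k] by (simp add: add.commute[of _ a])
    then have "ennreal (pmf (sum_pmf p (Suc n)) k) =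
      (\<Sum>a. ennreal (pmf (sum_pmf p n) a) * (if a \<le> k then ennreal (pmf p (k - a)) else 0))"
      by (simp add: ennreal_pmf_bind nn_integral_measure_pmf_nat)
    then show ?thesis by (metis enn2real_ennreal pmf_nonneg)
  qed
  with Suc show ?case by simp
qed simp

text \<open>The index \<open>y - m\<close> must be fixed before measurability in the offspring law
  applies, so the expression is split over the finitely many immigration values
  \<open>m <= y\<close> that contribute.\<close>

lemma measurable_bpire_step:
  assumes [measurable]: "phi \<in> Q \<rightarrow>\<^sub>M pmf_space" "M \<in> Q \<rightarrow>\<^sub>M count_space UNIV"
  shows "(\<lambda>\<omega>. pmf (map_pmf (\<lambda>s. s + M \<omega>) (sum_pmf (phi \<omega>) x)) y) \<in> borel_measurable Q"
proof -
  have "pmf (map_pmf (\<lambda>s. s + M \<omega>) (sum_pmf (phi \<omega>) x)) y =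
      (\<Sum>m\<le>y. if M \<omega> = m then pmf (sum_pmf (phi \<omega>) x) (y - m) else 0)" for \<omega>
    by (simp add: pmf_map_add)
  then show ?thesis by simp
qed

lemma bpire_kernel_nonneg: "0 \<le> bpire_kernel Q phi M x y"
  by (simp add: bpire_kernel_def)

text \<open>Tonelli: the sum over target states moves inside the integral over the environment.
  Estimates can then be made in a frozen environment and integrated afterwards.\<close>

lemma suminf_bpire_kernel:
  assumes "prob_space Q" "phi \<in> Q \<rightarrow>\<^sub>M pmf_space" "M \<in> Q \<rightarrow>\<^sub>M count_space UNIV"
  shows "(\<Sum>y. ennreal (bpire_kernel Q phi M x y) * f y) =
    (\<integral>\<^sup>+\<omega>. \<integral>\<^sup>+s. f (s + M \<omega>) \<partial>sum_pmf (phi \<omega>) x \<partial>Q)"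
proof -
  interpret prob_space Q by fact
  note [measurable] = measurable_bpire_step[OF assms(2,3)]
  have "ennreal (bpire_kernel Q phi M x y) =
      (\<integral>\<^sup>+\<omega>. ennreal (pmf (map_pmf (\<lambda>s. s + M \<omega>) (sum_pmf (phi \<omega>) x)) y) \<partial>Q)" for y
    unfolding bpire_kernel_def
    by (intro nn_integral_eq_integral[symmetric] integrable_const_bound[where B=1])
       (auto simp: pmf_le_1)
  then have "(\<Sum>y. ennreal (bpire_kernel Q phi M x y) * f y) =
     (\<integral>\<^sup>+\<omega>. (\<Sum>y. ennreal (pmf (map_pmf (\<lambda>s. s + M \<omega>) (sum_pmf (phi \<omega>) x)) y) * f y) \<partial>Q)"
    by (subst nn_integral_suminf) (auto simp: nn_integral_multc)
  then show ?thesis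
    by (simp add: nn_integral_measure_pmf_nat[symmetric])
qed

lemma bpire_kernel_sums_1:
  assumes "prob_space Q" "phi \<in> Q \<rightarrow>\<^sub>M pmf_space" "M \<in> Q \<rightarrow>\<^sub>M count_space UNIV"
  shows "bpire_kernel Q phi M x sums 1"
proof -
  have "(\<Sum>y. ennreal (bpire_kernel Q phi M x y)) = ennreal 1"
    using suminf_bpire_kernel[OF assms, of x "\<lambda>_. 1"] prob_space.emeasure_space_1[OF assms(1)]
    by (simp add: measure_pmf.emeasure_space_1)
  then have "(\<lambda>y. ennreal (bpire_kernel Q phi M x y)) sums ennreal 1"
    by (metis summableI summable_sums)
  then show ?thesis
    by (subst (asm) sums_ennreal) (auto simp: bpire_kernel_nonneg)
qed

section \<open>Variance and lower deviations of a sum of offspring\<close>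

lemma nn_integral_sum_pmf_square:
  fixes p :: "nat pmf"
  assumes "pmf_mean p < \<infinity>" "pmf_var p < \<infinity>"
  defines "m \<equiv> enn2real (pmf_mean p)" and "v \<equiv> enn2real (pmf_var p)"
  shows "(\<integral>\<^sup>+s. ennreal ((real s - real n * m)\<^sup>2) \<partial>sum_pmf p n) = ennreal (real n * v)"
proof (induction n)
  case (Suc n)
  have I1: "integrable (measure_pmf p) real"
    using assms(1) by (auto intro!: integrableI_bounded simp: pmf_mean_def)
  have m: "measure_pmf.expectation p real = m"
    unfolding m_def pmf_mean_def by (subst integral_eq_nn_integral) auto
  have nn: "(\<integral>\<^sup>+k. ennreal ((real k - m)\<^sup>2) \<partial>p) = pmf_var p"
    using assms(1) by (auto simp: pmf_var_def m_def)
  have I2: "integrable (measure_pmf p) (\<lambda>k. (real k - m)\<^sup>2)"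
    using assms(2) nn by (intro integrableI_bounded) auto
  have v: "measure_pmf.expectation p (\<lambda>k. (real k - m)\<^sup>2) = v"
    unfolding v_def nn[symmetric] by (subst integral_eq_nn_integral) auto
  \<comment> \<open>Here \<open>c\<close> stands for the centred sum of the first \<open>n\<close>
    summands. The cross term \<open>2 * c * (real b - m)\<close> has mean zero, so the variances
    add.\<close>
  have "(\<integral>\<^sup>+b. ennreal ((c + (real b - m))\<^sup>2) \<partial>p) = ennreal (c\<^sup>2) + ennreal v" for c
  proof -
    have eq: "(c + (real b - m))\<^sup>2 = c\<^sup>2 + 2 * c * (real b - m) + (real b - m)\<^sup>2" for b
      by (simp add: power2_eq_square algebra_simps)
    have I: "integrable (measure_pmf p) (\<lambda>b. c\<^sup>2 + 2 * c * (real b - m) + (real b - m)\<^sup>2)"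
      by (intro Bochner_Integration.integrable_add integrable_mult_right
            Bochner_Integration.integrable_diff I1 I2) auto
    have "measure_pmf.expectation p (\<lambda>b. c\<^sup>2 + 2 * c * (real b - m) + (real b - m)\<^sup>2) = c\<^sup>2 + v"
      using I1 I2 by (simp add: m v)
    with I have "(\<integral>\<^sup>+b. ennreal ((c + (real b - m))\<^sup>2) \<partial>p) = ennreal (c\<^sup>2 + v)"
      by (subst nn_integral_eq_integral) (auto simp: eq[symmetric])
    then show ?thesis by (simp add: v_def)
  qed
  moreover have "real (a + b) - real (Suc n) * m = (real a - real n * m) + (real b - m)" for a b
    by (simp add: algebra_simps)
  ultimately have "(\<integral>\<^sup>+b. ennreal ((real (a + b) - real (Suc n) * m)\<^sup>2) \<partial>p) =
      ennreal ((real a - real n * m)\<^sup>2) + ennreal v" for a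
    by presburger
  then have "(\<integral>\<^sup>+s. ennreal ((real s - real (Suc n) * m)\<^sup>2) \<partial>sum_pmf p (Suc n)) =
     (\<integral>\<^sup>+a. ennreal ((real a - real n * m)\<^sup>2) + ennreal v \<partial>sum_pmf p n)"
    by simp
  also have "\<dots> = ennreal (real n * v) + ennreal v"
    by (subst nn_integral_add) (auto simp: Suc measure_pmf.emeasure_space_1)
  also have "\<dots> = ennreal (real (Suc n) * v)"
    by (simp add: v_def ennreal_plus[symmetric] algebra_simps del: ennreal_plus)
  finally show ?case .
qed simp

text \<open>Only the lower tail is needed, because the Lyapunov function decreases and a larger
  population can only help. The variance enters through \<open>v / m^2\<close>, the ratio whose
  \<open>log_plus\<close> is square integrable in the theorem.\<close>

lemma sum_pmf_Chebyshev:
  fixes p :: "nat pmf"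
  defines "m \<equiv> enn2real (pmf_mean p)" and "v \<equiv> enn2real (pmf_var p)"
  assumes "pmf_mean p < \<infinity>" "pmf_var p < \<infinity>" "0 < m" "0 < n" "0 < h"
  shows "measure (sum_pmf p n) {s. real s < real n * m * (1 - h)} \<le> v / m\<^sup>2 / (real n * h\<^sup>2)"
proof -
  let ?c = "real n * m * h"
  have c: "0 < ?c" using assms by simp
  have "indicator {s. real s < real n * m * (1 - h)} s
      \<le> ennreal (1 / ?c\<^sup>2) * ennreal ((real s - real n * m)\<^sup>2)" for s
  proof (cases "real s < real n * m * (1 - h)")
    case True
    then have "?c \<le> real n * m - real s" by (simp add: algebra_simps)
    with c have "?c\<^sup>2 \<le> (real n * m - real s)\<^sup>2" by (intro power_mono) auto
    then have "1 \<le> 1 / ?c\<^sup>2 * (real s - real n * m)\<^sup>2"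
      using c assms by (simp add: power2_commute)
    then have "ennreal 1 \<le> ennreal (1 / ?c\<^sup>2 * (real s - real n * m)\<^sup>2)"
      by (rule ennreal_leI)
    with True show ?thesis by (subst ennreal_mult[symmetric]) auto
  qed auto
  then have "(\<integral>\<^sup>+s. indicator {s. real s < real n * m * (1 - h)} s \<partial>sum_pmf p n) \<le>
      (\<integral>\<^sup>+s. ennreal (1 / ?c\<^sup>2) * ennreal ((real s - real n * m)\<^sup>2) \<partial>sum_pmf p n)"
    by (intro nn_integral_mono) auto
  also have "\<dots> = ennreal (1 / ?c\<^sup>2 * (real n * v))"
    using nn_integral_sum_pmf_square[OF assms(3,4), of n] unfolding m_def v_def
    by (subst nn_integral_cmult) (auto simp: ennreal_mult[symmetric] simp del: times_divide_eq_left)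
  finally have "measure (sum_pmf p n) {s. real s < real n * m * (1 - h)} \<le> 1 / ?c\<^sup>2 * (real n * v)"
    by (simp add: measure_pmf.emeasure_eq_measure v_def)
  also have "\<dots> = v / m\<^sup>2 / (real n * h\<^sup>2)"
    using assms by (simp add: field_simps power2_eq_square)
  finally show ?thesis .
qed

section \<open>The Lyapunov function and its one-step change in a fixed environment\<close>

definition lyap :: "real \<Rightarrow> real \<Rightarrow> real" where
  "lyap e t = (1 + max 0 t) powr (- e)"

lemma lyap_pos: "0 < lyap e t"
  by (simp add: lyap_def)

lemma lyap_le_1: "0 \<le> e \<Longrightarrow> lyap e t \<le> 1"
  using powr_mono2'[of "-e" 1 "1 + max 0 t"] by (simp add: lyap_def)

lemma lyap_antimono: "0 \<le> e \<Longrightarrow> s \<le> t \<Longrightarrow> lyap e t \<le> lyap e s"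
  unfolding lyap_def by (intro powr_mono2') auto

text \<open>A Taylor estimate valid for all \<open>y\<close>. The linear term carries the exact
  derivative of \<open>(1 + u) powr (- e)\<close>, so that it cancels on averaging a centred
  \<open>y\<close>. In the scale \<open>s = y / (1 + u)\<close>, the range \<open>s >= -1/2\<close>
  is handled by an expansion; below it the quadratic term alone exceeds 1, an upper bound for
  \<open>lyap\<close>.\<close>

lemma lyap_quadratic_bound:
  assumes e: "0 \<le> e" "e \<le> 1" and u: "0 \<le> u"
  shows "lyap e (u + y) \<le> lyap e u - e * (1 + u) powr (- e - 1) * y + 4 * y\<^sup>2 / (1 + u)\<^sup>2"
proof -
  define s where "s = y / (1 + u)"
  have y: "y = s * (1 + u)" using u by (simp add: s_def)
  have D: "e * (1 + u) powr (- e - 1) * y = lyap e u * (e * s)"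
    using u by (simp add: y lyap_def powr_diff)
  have q: "4 * y\<^sup>2 / (1 + u)\<^sup>2 = 4 * s\<^sup>2" by (simp add: s_def power_divide)
  show ?thesis
  proof (cases "- (1 / 2) \<le> s")
    case True
    have "(1 + s) * (1 - s + 2 * s\<^sup>2) = 1 + s\<^sup>2 * (1 + 2 * s)"
      by (simp add: power2_eq_square algebra_simps)
    moreover have "0 \<le> s\<^sup>2 * (1 + 2 * s)" using True by simp
    ultimately have inv: "1 / (1 + s) \<le> 1 - s + 2 * s\<^sup>2"
      using True by (simp add: divide_le_eq mult.commute)
    \<comment> \<open>Weighted arithmetic-geometric mean inequality with weights \<open>e\<close>
      and \<open>1 - e\<close>; it trades the power for the fraction already bounded in
      \<open>inv\<close>.\<close>
    have "(1 / (1 + s)) powr e * 1 powr (1 - e) \<le> e * (1 / (1 + s)) + (1 - e) * 1"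
      using e True by (intro Youngs_inequality_0) auto
    also have "\<dots> \<le> e * (1 - s + 2 * s\<^sup>2) + (1 - e)"
      using mult_left_mono[OF inv e(1)] by simp
    finally have "(1 + s) powr (- e) \<le> 1 - e * s + 2 * (e * s\<^sup>2)"
      using True by (simp add: powr_divide powr_minus_divide algebra_simps)
    also have "\<dots> \<le> 1 - e * s + 2 * s\<^sup>2"
      using e mult_right_mono[of e 1 "s\<^sup>2"] by simp
    finally have b: "(1 + s) powr (- e) \<le> 1 - e * s + 2 * s\<^sup>2" .
    have "1 + (u + y) = (1 + u) * (1 + s)" by (simp add: y algebra_simps)
    moreover have "0 < (1 + u) * (1 + s)" using u True by simp
    ultimately have "lyap e (u + y) \<le> ((1 + u) * (1 + s)) powr (- e)"
      unfolding lyap_def using e by (intro powr_mono2') auto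
    also have "\<dots> = lyap e u * (1 + s) powr (- e)"
      using u True by (simp add: powr_mult lyap_def)
    also have "\<dots> \<le> lyap e u * (1 - e * s + 2 * s\<^sup>2)"
      using b lyap_pos[of e u] by (intro mult_left_mono) auto
    also have "\<dots> = lyap e u - lyap e u * (e * s) + 2 * (lyap e u * s\<^sup>2)"
      by (simp add: algebra_simps)
    also have "\<dots> \<le> lyap e u - lyap e u * (e * s) + 4 * s\<^sup>2"
      using mult_right_mono[OF lyap_le_1[OF e(1), of u], of "s\<^sup>2"] zero_le_power2[of s]
      by linarith
    finally show ?thesis by (simp add: D q)
  next
    case False
    then have "(1 / 2)\<^sup>2 \<le> (- s)\<^sup>2" by (intro power_mono) auto
    then have "1 \<le> 4 * s\<^sup>2" by (simp add: power2_eq_square)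
    moreover have "lyap e u * (e * s) \<le> 0"
      using False e lyap_pos[of e u] by (simp add: mult_le_0_iff)
    ultimately show ?thesis
      using lyap_le_1[OF e(1), of "u + y"] lyap_pos[of e u] by (simp add: D q)
  qed
qed

lemma log_plus_eq_ln: "1 < x \<Longrightarrow> log_plus x = ln x"
  by (simp add: log_plus_def)

text \<open>In a fixed environment the offspring sum either drops below
  \<open>x * m * (1 - h)\<close>, which costs at most its probability, or leaves the log of the
  state at least at \<open>T\<close>. Immigration beyond \<open>exp (4 * u)\<close> improves the
  value to \<open>lyap e (4 * u)\<close> and yields the subtracted term. The linear term in
  \<open>ln m\<close> is kept apart because it integrates to zero.\<close>

lemma lyap_step_bound:
  fixes p :: "nat pmf"
  defines "m \<equiv> enn2real (pmf_mean p)" and "v \<equiv> enn2real (pmf_var p)"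
  assumes p: "pmf_mean p < \<infinity>" "pmf_var p < \<infinity>" "0 < m"
    and e: "0 \<le> e" "e \<le> 1" and u: "u = ln (real x)" "2 \<le> u"
  shows "measure_pmf.expectation (sum_pmf p x) (\<lambda>s. lyap e (ln (real (s + k)))) \<le>
    lyap e u - e * (1 + u) powr (- e - 1) * ln m
    + (6 + 12 * (ln m)\<^sup>2 + 4 * (log_plus (v / m\<^sup>2))\<^sup>2) / u\<^sup>2 + u ^ 4 * exp (- u / 2)
    - (if 0 < k \<and> ln (real k) > 4 * u then lyap e (3 * u / 2) - lyap e (4 * u) else 0)"
proof -
  \<comment> \<open>Chebyshev is used with the relative deviation \<open>h\<close>: the loss \<open>- ln (1 - h)\<close> on the log scale
    has to be \<open>O(1 / u\<^sup>2)\<close>, so a constant deviation would be too coarse.\<close>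
  define h where "h = 1 / u\<^sup>2"
  define a where "a = - ln (1 - h)"
  define T where "T = u + (ln m - a)"
  define L where "L = log_plus (v / m\<^sup>2)"
  let ?y = "ln m"
  let ?A = "0 < k \<and> ln (real k) > 4 * u"
  let ?B = "{s::nat. real s < real x * m * (1 - h)}"
  let ?D = "e * (1 + u) powr (- e - 1)"
  have u4: "4 \<le> u\<^sup>2" using power_mono[OF u(2), of 2] by simp
  have h: "0 < h" "h \<le> 1 / 4" using u4 u by (auto simp: h_def divide_le_eq)
  have "h * h \<le> 1 / 4 * h" using h by (intro mult_right_mono) auto
  with ln_one_minus_pos_lower_bound[of h] h have "a \<le> 2 * h"
    unfolding a_def power2_eq_square by linarith
  with h have a: "0 \<le> a" "a \<le> 2 * h" by (auto simp: a_def)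
  have x: "0 < x" using u by (cases x) auto
  have xu: "real x = exp u" using u x by simp
  \<comment> \<open>The threshold is the square root of \<open>x = exp u\<close>. Below it
    Chebyshev, with \<open>h^2 = u^(-4)\<close>, leaves an exponentially small bound; above it
    \<open>L >= u / 2\<close>, so \<open>4 * L^2 / u^2 >= 1\<close> bounds any probability.\<close>
  have bad: "measure (sum_pmf p x) ?B \<le> u ^ 4 * exp (- u / 2) + 4 * L\<^sup>2 / u\<^sup>2"
  proof (cases "v / m\<^sup>2 \<le> exp (u / 2)")
    case True
    have "measure (sum_pmf p x) ?B \<le> v / m\<^sup>2 / (real x * h\<^sup>2)"
      unfolding m_def v_def using p x h by (intro sum_pmf_Chebyshev) (auto simp: m_def)
    also have "\<dots> \<le> exp (u / 2) / (real x * h\<^sup>2)"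
      using True by (intro divide_right_mono) auto
    also have "\<dots> = u ^ 4 * exp (- u / 2)"
      by (simp add: xu h_def power_divide exp_minus field_simps flip: exp_add power_mult)
    also have "\<dots> \<le> u ^ 4 * exp (- u / 2) + 4 * L\<^sup>2 / u\<^sup>2" by simp
    finally show ?thesis .
  next
    case False
    have "1 < exp (u / 2)" using u by (subst one_less_exp_iff) simp
    with False have "1 < v / m\<^sup>2" by linarith
    then have L: "L = ln (v / m\<^sup>2)" unfolding L_def by (rule log_plus_eq_ln)
    have pos: "0 < v / m\<^sup>2" using \<open>1 < v / m\<^sup>2\<close> by linarith
    have "exp (u / 2) < exp L" unfolding L exp_ln[OF pos] using False by linarith
    then have "u / 2 \<le> L" by simp
    then have "(u / 2)\<^sup>2 \<le> L\<^sup>2" using u by (intro power_mono) auto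
    then have "1 \<le> 4 * L\<^sup>2 / u\<^sup>2" using u by (simp add: field_simps)
    moreover have "0 \<le> u ^ 4 * exp (- u / 2)" by simp
    ultimately show ?thesis using measure_pmf.prob_le_1[of "sum_pmf p x" ?B] by linarith
  qed
  \<comment> \<open>On the bad event the indicator alone covers every possible value of
    \<open>lyap\<close>. Under heavy immigration the \<open>k\<close> immigrants by themselves
    suffice, whatever \<open>s\<close> is.\<close>
  have pw: "lyap e (ln (real (s + k))) \<le> indicator ?B s + (if ?A then lyap e (4 * u) else lyap e T)"
    for s
  proof (cases "?A")
    case True
    have "ln (real k) \<le> ln (real (s + k))" using True by (subst ln_le_cancel_iff) auto
    with True have "4 * u \<le> ln (real (s + k))" by linarith
    with e have "lyap e (ln (real (s + k))) \<le> lyap e (4 * u)"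
      by (intro lyap_antimono)
    with True show ?thesis by (simp add: add_increasing)
  next
    case nA: False
    show ?thesis
    proof (cases "s \<in> ?B")
      case True
      with nA show ?thesis
        using lyap_le_1[OF e(1), of "ln (real (s + k))"] lyap_pos[of e T] by auto
    next
      case False
      have pos: "0 < real x * m * (1 - h)" using x p h by simp
      have "T = ln (real x * m * (1 - h))"
        using x p h by (simp add: T_def a_def u ln_mult)
      also have "\<dots> \<le> ln (real (s + k))"
        using False pos by (subst ln_le_cancel_iff) auto
      finally have "lyap e (ln (real (s + k))) \<le> lyap e T" using e by (intro lyap_antimono)
      with nA False show ?thesis by auto
    qed
  qed
  have iB: "integrable (sum_pmf p x) (indicat_real ?B)"
    by (intro measure_pmf.integrable_const_bound[where B=1]) (auto simp: indicator_def)
  have "measure_pmf.expectation (sum_pmf p x) (\<lambda>s. lyap e (ln (real (s + k)))) \<le>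
    measure_pmf.expectation (sum_pmf p x)
      (\<lambda>s. indicator ?B s + (if ?A then lyap e (4 * u) else lyap e T))"
  proof (rule integral_mono[OF _ _ pw])
    show "integrable (sum_pmf p x) (\<lambda>s. lyap e (ln (real (s + k))))"
      using lyap_pos[of e] lyap_le_1[OF e(1)]
      by (intro measure_pmf.integrable_const_bound[where B=1]) (auto simp: less_imp_le)
  qed (use iB in \<open>auto intro!: Bochner_Integration.integrable_add\<close>)
  also have "\<dots> = measure (sum_pmf p x) ?B + (if ?A then lyap e (4 * u) else lyap e T)"
    by (subst Bochner_Integration.integral_add) (use iB in auto)
  \<comment> \<open>The level \<open>3 * u / 2\<close> serves as an intermediate value:
    \<open>T <= 3 * u / 2\<close> as long as \<open>ln m <= u / 2\<close>, and otherwise the term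
    \<open>4 * (ln m)^2 / u^2\<close> is at least 1.\<close>
  also have "(if ?A then lyap e (4 * u) else lyap e T) \<le>
      lyap e T + 4 * ?y\<^sup>2 / u\<^sup>2 - (if ?A then lyap e (3 * u / 2) - lyap e (4 * u) else 0)"
  proof -
    have "lyap e (3 * u / 2) \<le> lyap e T + 4 * ?y\<^sup>2 / u\<^sup>2"
    proof (cases "?y \<le> u / 2")
      case True
      with a have "lyap e (3 * u / 2) \<le> lyap e T" by (intro lyap_antimono e) (auto simp: T_def)
      moreover have "0 \<le> 4 * ?y\<^sup>2 / u\<^sup>2" by simp
      ultimately show ?thesis by linarith
    next
      case False
      then have "(u / 2)\<^sup>2 \<le> ?y\<^sup>2" using u by (intro power_mono) auto
      then have "1 \<le> 4 * ?y\<^sup>2 / u\<^sup>2" using u by (simp add: field_simps)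
      then show ?thesis using lyap_le_1[OF e(1), of "3 * u / 2"] lyap_pos[of e T] by linarith
    qed
    moreover have "0 \<le> 4 * ?y\<^sup>2 / u\<^sup>2" by simp
    ultimately show ?thesis by auto
  qed
  \<comment> \<open>The quadratic bound is used with increment \<open>ln m - a\<close>. All
    contributions of \<open>a\<close> add up to at most \<open>3 * a <= 6 / u^2\<close>, the source
    of the constant 6. The 8 here and the 4 of the preceding step make up the 12.\<close>
  also have "lyap e T \<le> lyap e u - ?D * ?y + (6 + 8 * ?y\<^sup>2) / u\<^sup>2"
  proof -
    have "(1 + u) powr (- e - 1) \<le> 1"
      using powr_mono2'[of "- e - 1" 1 "1 + u"] e u by simp
    with e have D: "0 \<le> ?D" "?D \<le> 1" by (auto intro: mult_le_one)
    have sq: "(?y - a)\<^sup>2 \<le> 2 * ?y\<^sup>2 + 2 * a\<^sup>2"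
      using zero_le_power2[of "?y + a"] by (simp add: power2_eq_square algebra_simps)
    have "a * a \<le> 1 * a" using a h by (intro mult_right_mono) auto
    then have a2: "a\<^sup>2 \<le> a" by (simp add: power2_eq_square)
    have "lyap e T \<le> lyap e u - ?D * (?y - a) + 4 * (?y - a)\<^sup>2 / (1 + u)\<^sup>2"
      unfolding T_def using e u by (intro lyap_quadratic_bound) auto
    also have "4 * (?y - a)\<^sup>2 / (1 + u)\<^sup>2 \<le> 4 * (?y - a)\<^sup>2 / u\<^sup>2"
      using u by (intro divide_left_mono power_mono mult_pos_pos) auto
    also have "\<dots> \<le> (8 * ?y\<^sup>2 + 8 * a) / u\<^sup>2"
      using sq a2 by (intro divide_right_mono) auto
    also have "\<dots> = 8 * ?y\<^sup>2 / u\<^sup>2 + a * (8 / u\<^sup>2)"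
      by (simp add: add_divide_distrib)
    also have "a * (8 / u\<^sup>2) \<le> a * 2"
      using a u4 u by (intro mult_left_mono) (auto simp: divide_le_eq)
    finally have "lyap e T \<le> lyap e u - ?D * (?y - a) + (8 * ?y\<^sup>2 / u\<^sup>2 + a * 2)" by simp
    also have "?D * (?y - a) = ?D * ?y - ?D * a" by (rule right_diff_distrib)
    finally have "lyap e T \<le> lyap e u - ?D * ?y + (8 * ?y\<^sup>2 / u\<^sup>2 + a * 3)"
      using mult_right_mono[OF D(2) a(1)] by linarith
    also have "a * 3 \<le> 6 / u\<^sup>2" using a(2) by (simp add: h_def)
    finally show ?thesis by (simp add: add_divide_distrib)
  qed
  finally show ?thesis using bad unfolding L_def[symmetric] by (simp add: add_divide_distrib)
qed

section \<open>Averaging over the environment, and comparison of gain and loss\<close>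

lemma bpire_drift_bound:
  assumes Q: "prob_space Q" and meas: "phi \<in> Q \<rightarrow>\<^sub>M pmf_space" "M \<in> Q \<rightarrow>\<^sub>M count_space UNIV"
  defines "y \<equiv> \<lambda>\<omega>. ln (enn2real (pmf_mean (phi \<omega>)))"
    and "L \<equiv> \<lambda>\<omega>. log_plus (enn2real (pmf_var (phi \<omega>)) / (enn2real (pmf_mean (phi \<omega>)))\<^sup>2)"
  assumes mu: "AE \<omega> in Q. 0 < pmf_mean (phi \<omega>) \<and> pmf_mean (phi \<omega>) < \<infinity>"
    and var: "AE \<omega> in Q. pmf_var (phi \<omega>) < \<infinity>"
    and int: "integrable Q (\<lambda>\<omega>. (y \<omega>)\<^sup>2)" "integrable Q (\<lambda>\<omega>. (L \<omega>)\<^sup>2)"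
    and y0: "(\<integral>\<omega>. y \<omega> \<partial>Q) = 0"
    and e: "0 \<le> e" "e \<le> 1" and u: "u = ln (real x)" "2 \<le> u"
  shows "(\<Sum>z. ennreal (bpire_kernel Q phi M x z) * ennreal (lyap e (ln (real z)))) \<le>
    ennreal (lyap e u + (6 + 12 * (\<integral>\<omega>. (y \<omega>)\<^sup>2 \<partial>Q) + 4 * (\<integral>\<omega>. (L \<omega>)\<^sup>2 \<partial>Q)) / u\<^sup>2
      + u ^ 4 * exp (- u / 2)
      - measure Q {\<omega> \<in> space Q. 0 < M \<omega> \<and> ln (real (M \<omega>)) > 4 * u}
        * (lyap e (3 * u / 2) - lyap e (4 * u)))"
proof -
  interpret prob_space Q by fact
  note [measurable] = meas
  define A where "A = {\<omega> \<in> space Q. 0 < M \<omega> \<and> ln (real (M \<omega>)) > 4 * u}"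
  have A[measurable]: "A \<in> sets Q" unfolding A_def by measurable
  have [measurable]: "y \<in> borel_measurable Q" unfolding y_def by measurable
  have iy: "integrable Q y"
    by (rule square_integrable_imp_integrable) (use int in auto)
  let ?D = "e * (1 + u) powr (- e - 1)" and ?G = "lyap e (3 * u / 2) - lyap e (4 * u)"
  let ?E = "\<lambda>\<omega>. measure_pmf.expectation (sum_pmf (phi \<omega>) x) (\<lambda>s. lyap e (ln (real (s + M \<omega>))))"
  \<comment> \<open>The linear term has order \<open>u powr (- e - 1)\<close>, which for
    \<open>e < 1\<close> decays more slowly than \<open>1 / u^2\<close>; it disappears from the
    integral of \<open>B\<close> because \<open>y\<close> is centred.\<close>
  define B where "B \<omega> = lyap e u - ?D * y \<omega> + (6 + 12 * (y \<omega>)\<^sup>2 + 4 * (L \<omega>)\<^sup>2) / u\<^sup>2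
    + u ^ 4 * exp (- u / 2) - indicator A \<omega> * ?G" for \<omega>
  have iA: "integrable Q (\<lambda>\<omega>. indicator A \<omega> * ?G)"
    by (intro integrable_mult_left) (auto simp: emeasure_eq_measure)
  have iB: "integrable Q B"
    unfolding B_def using iy int iA by auto
  have B: "(\<integral>\<omega>. B \<omega> \<partial>Q) = lyap e u
      + (6 + 12 * (\<integral>\<omega>. (y \<omega>)\<^sup>2 \<partial>Q) + 4 * (\<integral>\<omega>. (L \<omega>)\<^sup>2 \<partial>Q)) / u\<^sup>2
      + u ^ 4 * exp (- u / 2) - measure Q A * ?G"
    unfolding B_def using iy int iA y0 by (simp add: prob_space)
  have E0: "0 \<le> ?E \<omega>" for \<omega>
    by (simp add: less_imp_le[OF lyap_pos])
  have EB: "AE \<omega> in Q. ?E \<omega> \<le> B \<omega>"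
    using mu var AE_space
  proof eventually_elim
    case (elim \<omega>)
    then show ?case
      using lyap_step_bound[of "phi \<omega>" e u x "M \<omega>"] e u
      unfolding B_def y_def L_def A_def by (auto simp: enn2real_positive_iff indicator_def)
  qed
  have "(\<Sum>z. ennreal (bpire_kernel Q phi M x z) * ennreal (lyap e (ln (real z)))) =
      (\<integral>\<^sup>+\<omega>. \<integral>\<^sup>+s. ennreal (lyap e (ln (real (s + M \<omega>)))) \<partial>sum_pmf (phi \<omega>) x \<partial>Q)"
    by (rule suminf_bpire_kernel[OF Q meas])
  also have "\<dots> = (\<integral>\<^sup>+\<omega>. ennreal (?E \<omega>) \<partial>Q)"
    using lyap_pos[of e] lyap_le_1[OF e(1)]
    by (intro nn_integral_cong nn_integral_eq_integral measure_pmf.integrable_const_bound[where B=1])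
       (auto simp: less_imp_le)
  also have "\<dots> \<le> (\<integral>\<^sup>+\<omega>. ennreal (B \<omega>) \<partial>Q)"
    using EB by (intro nn_integral_mono_AE) (auto intro: ennreal_leI)
  also have "\<dots> = ennreal (\<integral>\<omega>. B \<omega> \<partial>Q)"
  proof (rule nn_integral_eq_integral[OF iB])
    \<comment> \<open>\<open>B\<close> contains negative terms, but it dominates a nonnegative
      expectation almost everywhere.\<close>
    show "AE \<omega> in Q. 0 \<le> B \<omega>" using EB by eventually_elim (rule order_trans[OF E0])
  qed
  finally show ?thesis unfolding B A_def .
qed

text \<open>For \<open>u >= 2\<close> one has \<open>1 + 3 * u / 2 <= 2 * u\<close>, so the lower
  level sits at most at \<open>2 * u\<close> and the upper one at least at \<open>4 * u\<close>
  inside the power. Heavy immigration therefore gains a full multiple of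
  \<open>u powr (- e)\<close>.\<close>

lemma lyap_gap:
  assumes "0 \<le> e" "2 \<le> u"
  shows "(2 powr (- e) - 4 powr (- e)) * u powr (- e) \<le> lyap e (3 * u / 2) - lyap e (4 * u)"
proof -
  have "(2 * u) powr (- e) \<le> lyap e (3 * u / 2)" "lyap e (4 * u) \<le> (4 * u) powr (- e)"
    unfolding lyap_def using assms by (auto intro!: powr_mono2')
  then show ?thesis using assms by (simp add: powr_mult algebra_simps)
qed

text \<open>Compares the total loss with the gain, for later use with \<open>q = lam + e\<close>.
  After division by \<open>u powr (- q)\<close> the loss tends to zero, because
  \<open>q - 2 < 0\<close> and the exponential beats every power.\<close>

lemma drift_eventually_negative:
  assumes "0 < c" "q < 2"
  shows "eventually (\<lambda>u::real. K / u\<^sup>2 + u ^ 4 * exp (- u / 2) \<le> c * u powr (- q)) at_top"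
proof -
  have 1: "((\<lambda>u::real. K * u powr (q - 2) + u ^ 6 * exp (- u / 2) * u powr (q - 2)) \<longlongrightarrow> 0) at_top"
    using assms by real_asymp
  from order_tendstoD(2)[OF this \<open>0 < c\<close>]
  show ?thesis
    using eventually_gt_at_top[of 0]
  proof eventually_elim
    case (elim u)
    have "K / u\<^sup>2 + u ^ 4 * exp (- u / 2) =
      (K * u powr (q - 2) + u ^ 6 * exp (- u / 2) * u powr (q - 2)) * u powr (- q)"
      using elim(2) by (simp add: powr_diff powr_minus field_simps eval_nat_numeral)
    also have "\<dots> \<le> c * u powr (- q)"
      using elim by (intro mult_right_mono) auto
    finally show ?case .
  qed
qed

section \<open>Choice of the exponent, drift condition and transience\<close>

theorem theorem1p3:
  fixes Q :: "'w measure" and phi :: "nat \<Rightarrow> 'w \<Rightarrow> nat pmf" and M :: "nat \<Rightarrow> 'w \<Rightarrow> nat"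
    and S :: "nat set"
  assumes "prob_space Q"
    and iid_indep: "prob_space.indep_vars Q (\<lambda>_. env_space) (\<lambda>n \<omega>. (phi n \<omega>, M n \<omega>)) {1..}"
    and iid_distr: "\<forall>n\<ge>1. distr Q env_space (\<lambda>\<omega>. (phi n \<omega>, M n \<omega>))
                         = distr Q env_space (\<lambda>\<omega>. (phi 1 \<omega>, M 1 \<omega>))"
    and state_space: "S = UNIV \<or> S = {1..}"
    and closed: "closed_on (bpire_kernel Q (phi 1) (M 1)) S"
    and irred: "irreducible_on (bpire_kernel Q (phi 1) (M 1)) S"
    and mu_fin: "AE \<omega> in Q. 0 < pmf_mean (phi 1 \<omega>) \<and> pmf_mean (phi 1 \<omega>) < \<infinity>"
    and mu_mom: "\<forall>\<delta>::real. 0 < \<delta> \<and> \<delta> < 6 \<longrightarrow>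
                   integrable Q (\<lambda>\<omega>. \<bar>ln (enn2real (pmf_mean (phi 1 \<omega>)))\<bar> powr \<delta>)"
    and mu_centered: "(\<integral>\<omega>. ln (enn2real (pmf_mean (phi 1 \<omega>))) \<partial>Q) = 0"
    and var_fin: "AE \<omega> in Q. pmf_var (phi 1 \<omega>) < \<infinity>"
    and var_mom: "integrable Q (\<lambda>\<omega>. (log_plus (enn2real (pmf_var (phi 1 \<omega>))
                     / (enn2real (pmf_mean (phi 1 \<omega>)))\<^sup>2))\<^sup>2)"
    and immig: "\<exists>lam::real. 0 < lam \<and> lam < 2 \<and>
       Liminf at_top (\<lambda>t::real. ereal (t powr lam *
          measure Q {\<omega> \<in> space Q. 0 < M 1 \<omega> \<and> ln (real (M 1 \<omega>)) > t})) > 0"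
  shows "\<forall>x\<in>S. transient_state (bpire_kernel Q (phi 1) (M 1)) x"
proof -
  interpret prob_space Q by fact
  let ?P = "bpire_kernel Q (phi 1) (M 1)"
  define y where "y \<omega> = ln (enn2real (pmf_mean (phi 1 \<omega>)))" for \<omega>
  define L where "L \<omega> = log_plus (enn2real (pmf_var (phi 1 \<omega>)) / (enn2real (pmf_mean (phi 1 \<omega>)))\<^sup>2)" for \<omega>
  have pair: "(\<lambda>\<omega>. (phi 1 \<omega>, M 1 \<omega>)) \<in> Q \<rightarrow>\<^sub>M pmf_space \<Otimes>\<^sub>M count_space UNIV"
    using iid_indep unfolding indep_vars_def env_space_def by auto
  have meas: "phi 1 \<in> Q \<rightarrow>\<^sub>M pmf_space" "M 1 \<in> Q \<rightarrow>\<^sub>M count_space UNIV"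
    using measurable_compose[OF pair measurable_fst] measurable_compose[OF pair measurable_snd] by simp_all
  note P = bpire_kernel_nonneg[of Q "phi 1" "M 1"] bpire_kernel_sums_1[OF assms(1) meas]
  have "integrable Q (\<lambda>\<omega>. \<bar>y \<omega>\<bar> powr 2)"
    using mu_mom[rule_format, of 2] by (simp add: y_def)
  then have y2: "integrable Q (\<lambda>\<omega>. (y \<omega>)\<^sup>2)"
    by simp
  obtain lam where lam: "0 < lam" "lam < 2" and lim: "Liminf at_top (\<lambda>t::real. ereal (t powr lam *
          measure Q {\<omega> \<in> space Q. 0 < M 1 \<omega> \<and> ln (real (M 1 \<omega>)) > t})) > 0"
    using immig by blast
  obtain c where c: "0 < c" "ereal c < Liminf at_top (\<lambda>t::real. ereal (t powr lam *
          measure Q {\<omega> \<in> space Q. 0 < M 1 \<omega> \<and> ln (real (M 1 \<omega>)) > t}))"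
    using ereal_dense2[OF lim] by (auto simp: zero_ereal_def)
  \<comment> \<open>This gives \<open>lam + e = 1 + lam / 2 < 2\<close>, so the gain outweighs the
    loss of order \<open>1 / u^2\<close>.\<close>
  define e where "e = (2 - lam) / 2"
  have e: "0 < e" "e \<le> 1" "lam + e < 2" using lam by (auto simp: e_def field_simps)
  define V where "V z = lyap e (ln (real z))" for z :: nat
  define K where "K = 6 + 12 * (\<integral>\<omega>. (y \<omega>)\<^sup>2 \<partial>Q) + 4 * (\<integral>\<omega>. (L \<omega>)\<^sup>2 \<partial>Q)"
  \<comment> \<open>The immigration tail at \<open>4 * u\<close> is at least
    \<open>c * (4 * u) powr (- lam)\<close> for large \<open>u\<close>; multiplied by the lower
    bound for the gap it gives \<open>r * u powr (- (lam + e))\<close>.\<close>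
  define r where "r = c * 4 powr (- lam) * (2 powr (- e) - 4 powr (- e))"
  have gap: "0 < 2 powr (- e) - (4::real) powr (- e)"
    using powr_less_mono2_neg[of "- e" 2 4] e by simp
  have r: "0 < r" using c gap by (simp add: r_def)
  have V: "0 < V z" "V z \<le> 1" for z
    using lyap_pos lyap_le_1 e by (auto simp: V_def)
  have Vmono: "V w \<le> V z" if "z \<le> w" for z w
  proof (cases "z = 0")
    case True
    \<comment> \<open>Since \<open>ln 0 = 0\<close>, the state 0 receives the maximal value 1, the
      same as the state 1.\<close>
    then show ?thesis using V(2)[of w] by (simp add: V_def lyap_def)
  next
    case False
    with that show ?thesis unfolding V_def using e by (intro lyap_antimono) auto
  qed
  have "filterlim (\<lambda>u::real. 4 * u) at_top at_top" by real_asymp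
  from this[unfolded filterlim_iff, rule_format, OF less_LiminfD[OF c(2)]]
  have tail: "\<forall>\<^sub>F u in at_top. c < (4 * u) powr lam *
      measure Q {\<omega> \<in> space Q. 0 < M 1 \<omega> \<and> ln (real (M 1 \<omega>)) > 4 * u}"
    by simp
  \<comment> \<open>Formulated along real \<open>u\<close>, where the asymptotics live, and carried
    over to states afterwards through the limit of \<open>ln (real x)\<close>.\<close>
  have drift: "\<forall>\<^sub>F u in at_top. \<forall>x. u = ln (real x) \<longrightarrow>
      (\<Sum>z. ennreal (?P x z) * ennreal (V z)) \<le> ennreal (V x)"
    using tail drift_eventually_negative[OF r e(3), of K] eventually_ge_at_top[of 2]
  proof eventually_elim
    case (elim u)
    let ?m = "measure Q {\<omega> \<in> space Q. 0 < M 1 \<omega> \<and> ln (real (M 1 \<omega>)) > 4 * u}"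
    from elim have u: "2 \<le> u" and Ku: "K / u\<^sup>2 + u ^ 4 * exp (- u / 2) \<le> r * u powr (- (lam + e))"
      and cu: "c < (4 * u) powr lam * ?m" by auto
    have m: "c * (4 * u) powr (- lam) \<le> ?m"
      using cu u by (simp add: powr_minus field_simps)
    have "r * u powr (- (lam + e)) =
        (c * (4 * u) powr (- lam)) * ((2 powr (- e) - 4 powr (- e)) * u powr (- e))"
      using u by (simp add: r_def powr_mult powr_add[symmetric])
    also have "\<dots> \<le> ?m * (lyap e (3 * u / 2) - lyap e (4 * u))"
      using m lyap_gap[of e u] e u gap by (intro mult_mono) auto
    finally have "K / u\<^sup>2 + u ^ 4 * exp (- u / 2) \<le> ?m * (lyap e (3 * u / 2) - lyap e (4 * u))"
      using Ku by linarith
    then have le: "lyap e u + K / u\<^sup>2 + u ^ 4 * exp (- u / 2)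
        - ?m * (lyap e (3 * u / 2) - lyap e (4 * u)) \<le> lyap e u"
      by linarith
    show ?case
    proof (intro allI impI)
      fix x assume x: "u = ln (real x)"
      have "(\<Sum>z. ennreal (?P x z) * ennreal (V z)) \<le> ennreal (lyap e u + K / u\<^sup>2
          + u ^ 4 * exp (- u / 2) - ?m * (lyap e (3 * u / 2) - lyap e (4 * u)))"
        using bpire_drift_bound[OF assms(1) meas mu_fin var_fin y2[unfolded y_def] var_mom
            mu_centered, of e u x] e x u
        by (simp add: K_def y_def L_def V_def)
      also have "\<dots> \<le> ennreal (lyap e u)" using le by (rule ennreal_leI)
      finally show "(\<Sum>z. ennreal (?P x z) * ennreal (V z)) \<le> ennreal (V x)"
        by (simp add: V_def x)
    qed
  qed
  have "filterlim (\<lambda>x. ln (real x)) at_top sequentially"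
    by (rule filterlim_compose[OF ln_at_top filterlim_real_sequentially])
  from this[unfolded filterlim_iff, rule_format, OF drift]
  have "eventually (\<lambda>x. (\<Sum>z. ennreal (?P x z) * ennreal (V z)) \<le> ennreal (V x)) sequentially"
    by (rule eventually_mono) blast
  then obtain x0 where x0: "(\<Sum>z. ennreal (?P x z) * ennreal (V z)) \<le> ennreal (V x)" if "x \<ge> x0" for x
    by (auto simp: eventually_sequentially)
  have sm: "summable (\<lambda>z. ?P x z * f z)" if "\<And>z. 0 \<le> f z" "\<And>z. f z \<le> 1" for f x
    by (rule summable_comparison_test'[of "?P x" 0])
       (use that P in \<open>auto simp: sums_iff mult_left_le\<close>)
  have super: "(\<Sum>z. ?P x z * V z) \<le> V x" if "x \<ge> x0" for x
  proof -
    have "ennreal (\<Sum>z. ?P x z * V z) = (\<Sum>z. ennreal (?P x z) * ennreal (V z))"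
      using P(1) V sm[of V x] by (subst suminf_ennreal2[symmetric]) (auto simp: less_imp_le ennreal_mult)
    with x0[OF that] have "ennreal (\<Sum>z. ?P x z * V z) \<le> ennreal (V x)" by simp
    then show ?thesis using V(1)[of x] by (subst (asm) ennreal_le_iff) auto
  qed
  show ?thesis
  proof
    fix x assume x: "x \<in> S"
    \<comment> \<open>Being at least \<open>x0\<close> makes \<open>V\<close> superharmonic beyond
      \<open>x1\<close>; being at least \<open>x\<close> gives \<open>W x = 1\<close>; being at
      least 1 excludes the tie \<open>V 0 = V 1\<close>, so that \<open>V\<close> drops strictly
      from \<open>x1\<close> to \<open>Suc x1\<close>.\<close>
    define x1 where "x1 = max 1 (max x x0)"
    \<comment> \<open>Truncation at 1 repairs the finite set where \<open>V\<close> may fail to be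
      superharmonic: there \<open>W\<close> takes its maximum 1, and beyond \<open>x1\<close> both
      members of the minimum are superharmonic.\<close>
    define W where "W z = min 1 (V z / V x1)" for z
    have W: "0 \<le> W z" "W z \<le> 1" for z using V by (auto simp: W_def less_imp_le)
    have W1: "W z = 1" if "z \<le> x1" for z
      using Vmono[OF that] V(1)[of x1] by (simp add: W_def)
    have "(\<Sum>w. ?P z w * W w) \<le> W z" for z
    proof -
      have "(\<Sum>w. ?P z w * W w) \<le> (\<Sum>w. ?P z w)"
        using W P sm[OF W] by (intro suminf_le) (auto simp: mult_left_le sums_iff)
      then have le1: "(\<Sum>w. ?P z w * W w) \<le> 1" using P(2)[of z] by (simp add: sums_iff)
      show ?thesis
      proof (cases "z \<le> x1")
        case False
        have s: "summable (\<lambda>w. ?P z w * V w / V x1)"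
          using V by (intro summable_divide sm) (auto simp: less_imp_le)
        have "(\<Sum>w. ?P z w * W w) \<le> (\<Sum>w. ?P z w * V w / V x1)"
        proof (intro suminf_le sm W s)
          show "?P z w * W w \<le> ?P z w * V w / V x1" for w
            using mult_left_mono[of "W w" "V w / V x1" "?P z w"] P(1) by (simp add: W_def)
        qed
        also have "\<dots> = (\<Sum>w. ?P z w * V w) / V x1"
          using V by (intro suminf_divide sm) (auto simp: less_imp_le)
        also have "\<dots> \<le> V z / V x1"
          using super[of z] False V(1)[of x1] by (intro divide_right_mono) (auto simp: x1_def)
        finally show ?thesis using le1 by (simp add: W_def)
      qed (use le1 W1 in simp)
    qed
    moreover have "W (Suc x1) < 1"
    proof -
      have "ln (real x1) < ln (real (Suc x1))" "0 \<le> ln (real x1)" by (auto simp: x1_def)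
      then have "V (Suc x1) < V x1"
        unfolding V_def lyap_def using e by (intro powr_less_mono2_neg) auto
      then show ?thesis using V(1)[of x1] by (simp add: W_def)
    qed
    \<comment> \<open>Both possible state spaces contain every positive integer, so irreducibility
      supplies a path from \<open>x\<close> to the state \<open>Suc x1\<close>, where
      \<open>W < 1\<close>.\<close>
    moreover have "Suc x1 \<in> S" using state_space by auto
    then obtain n where "kernel_pow ?P n x (Suc x1) > 0"
      using irred x by (auto simp: irreducible_on_def)
    moreover have "W x = 1" by (rule W1) (simp add: x1_def)
    ultimately show "transient_state ?P x"
      by (intro transient_state_if_superharmonic[of ?P W x n "Suc x1"] P W)
  qed
qed

end
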